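(* There is an absolute constant $c>0$ such that the following holds. Consider a $1$-layer transformer with $h$ heads, embedding dimension $d$ and precision $p$ bits, followed by an MLP of arbitrary width and depth. If this model solves the Most Frequent Element task for all sequences of length $n$ over a vocabulary of size $m$, then $$dhp\ \ge\ c\,\min\{m,n\},$$ i.e. $dhp\ge\Omega(\min\{m,n\})$.
   Context: Notation: $[m]=\{1,\dots,m\}$. Model. Each token $a\in[m]$ has an embedding $\mathbf{v}_a\in\mathbb{R}^d$ and each position $i$ a positional embedding $\mathbf{p}_i\in\mathbb{R}^d$; the input matrix $X$ has columns $X_i=\mathbf{v}_{x_i}+\mathbf{p}_i$. For each head $j\in[h]$ there are matrices $W_Q^{(j)},W_K^{(j)},W_V^{(j)}\in\mathbb{R}^{d\times d}$. The attention matrix of head $j$ is $A^{(j)}=\mathrm{SM}\big((W_K^{(j)}X)^\top(W_Q^{(j)}X)/\sqrt d\big)$, where $\mathrm{SM}$ is the row-wise softmax, and the head's output is $W_V^{(j)}X(A^{(j)})^\top$. The outputs of the heads are combined (with a residual connection to $X$), and an MLP (a ReLU network of arbitrary width and depth) is applied to the column of the last position to produce the scalar output of the model. All calculations, including the softmax (numerators and normalization sums) and intermediate accumulations over positions, are performed with finite precision of $p$ bits, i.e. every such scalar quantity is represented by $p$ bits. Most Frequent Element (MFE) task: given $x_1,\dots,x_n\in[m]$, let $c_z=\sum_{i=1}^n\mathbb{I}[x_i=z]$ be the count of token $z$; the target output is $y_{MFE}=\max_{z\in[m]}c_z$. *)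

theory Defs
  imports Complex_Main "Jordan_Normal_Form.Matrix"
begin

section \<open>Finite-precision arithmetic\<close>

text \<open>
  A \<open>p\<close>-bit number format is given by the rounding map that sends the exact result of a scalar
  operation to the representable number that is stored: there are at most \<open>2 ^ p\<close> stored values.
  Neither the set of representable numbers nor the rounding direction or overflow behaviour is
  prescribed, so fixed-point and (saturating) floating-point formats are all covered.
\<close>

definition p_bit_rounding :: "nat \<Rightarrow> (real \<Rightarrow> real) \<Rightarrow> bool" where
  "p_bit_rounding p rnd \<longleftrightarrow> finite (range rnd) \<and> card (range rnd) \<le> 2 ^ p"

text \<open>
  The operations below mirror the exact ones, every scalar operation being followed by \<open>rnd\<close>.
  Sums are accumulated from left to right, and every partial sum is rounded.  With \<open>rnd = id\<close>
  they are the exact operations.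
\<close>

definition fp_sum :: "(real \<Rightarrow> real) \<Rightarrow> real list \<Rightarrow> real" where
  "fp_sum rnd xs = foldl (\<lambda>s x. rnd (s + x)) 0 xs"

definition fp_scalar_prod :: "(real \<Rightarrow> real) \<Rightarrow> real vec \<Rightarrow> real vec \<Rightarrow> real" where
  "fp_scalar_prod rnd v w = fp_sum rnd (map (\<lambda>i. rnd (v $ i * w $ i)) [0..<dim_vec w])"

definition fp_add_vec :: "(real \<Rightarrow> real) \<Rightarrow> real vec \<Rightarrow> real vec \<Rightarrow> real vec" where
  "fp_add_vec rnd v w = vec (dim_vec w) (\<lambda>i. rnd (v $ i + w $ i))"

definition fp_mult_mat_vec :: "(real \<Rightarrow> real) \<Rightarrow> real mat \<Rightarrow> real vec \<Rightarrow> real vec" where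
  "fp_mult_mat_vec rnd A v = vec (dim_row A) (\<lambda>i. fp_scalar_prod rnd (row A i) v)"

definition fp_add_mat :: "(real \<Rightarrow> real) \<Rightarrow> real mat \<Rightarrow> real mat \<Rightarrow> real mat" where
  "fp_add_mat rnd A B = mat (dim_row B) (dim_col B) (\<lambda>ij. rnd (A $$ ij + B $$ ij))"

definition fp_mult_mat :: "(real \<Rightarrow> real) \<Rightarrow> real mat \<Rightarrow> real mat \<Rightarrow> real mat" where
  "fp_mult_mat rnd A B =
     mat (dim_row A) (dim_col B) (\<lambda>(i, j). fp_scalar_prod rnd (row A i) (col B j))"

text \<open>
  Row-wise softmax: the numerators, every partial normalization sum and the quotients are rounded.
  A normalization sum that rounds to zero yields zero quotients before rounding, because \<open>x / 0 = 0\<close>.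
\<close>

definition fp_softmax :: "(real \<Rightarrow> real) \<Rightarrow> real mat \<Rightarrow> real mat" where
  "fp_softmax rnd S =
     (let E = map_mat (\<lambda>s. rnd (exp s)) S
      in mat (dim_row S) (dim_col S)
           (\<lambda>(i, k). rnd (E $$ (i, k) / fp_sum rnd (map (\<lambda>l. E $$ (i, l)) [0..<dim_col S]))))"


section \<open>One-layer transformers\<close>

text \<open>
  \<open>W_O\<close> is the \<open>d \<times> d\<close> block belonging to the head in the usual \<open>d \<times> dh\<close> output projection of the
  concatenated head outputs; identity blocks correspond to the plain sum of the heads.
  The MLP is a list of (weight matrix, bias vector) layers.
\<close>

record attention_head =
  W_Q :: "real mat"
  W_K :: "real mat"
  W_V :: "real mat"
  W_O :: "real mat"

type_synonym mlp = "(real mat \<times> real vec) list"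

record transformer =
  token_emb :: "nat \<Rightarrow> real vec"
  pos_emb :: "nat \<Rightarrow> real vec"
  heads :: "attention_head list"
  final_mlp :: mlp

fun mlp_dims :: "nat \<Rightarrow> mlp \<Rightarrow> nat \<Rightarrow> bool" where
  "mlp_dims a [] b \<longleftrightarrow> a = b"
| "mlp_dims a ((W, v) # L) b \<longleftrightarrow>
     W \<in> carrier_mat (dim_row W) a \<and> v \<in> carrier_vec (dim_row W) \<and> mlp_dims (dim_row W) L b"

text \<open>
  Tokens are \<open>1, \<dots>, m\<close>, whereas positions are numbered \<open>0, \<dots>, n - 1\<close> to agree with the column
  indices of matrices.
\<close>

definition is_transformer :: "nat \<Rightarrow> nat \<Rightarrow> nat \<Rightarrow> nat \<Rightarrow> transformer \<Rightarrow> bool" where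
  "is_transformer m n d h T \<longleftrightarrow>
     (\<forall>a\<in>{1..m}. token_emb T a \<in> carrier_vec d) \<and>
     (\<forall>i<n. pos_emb T i \<in> carrier_vec d) \<and>
     length (heads T) = h \<and>
     (\<forall>H\<in>set (heads T). W_Q H \<in> carrier_mat d d \<and> W_K H \<in> carrier_mat d d \<and>
                        W_V H \<in> carrier_mat d d \<and> W_O H \<in> carrier_mat d d) \<and>
     final_mlp T \<noteq> [] \<and> mlp_dims d (final_mlp T) 1"

definition input_matrix :: "(real \<Rightarrow> real) \<Rightarrow> nat \<Rightarrow> transformer \<Rightarrow> nat list \<Rightarrow> real mat" where
  "input_matrix rnd d T x =
     mat_of_cols d (map (\<lambda>i. fp_add_vec rnd (token_emb T (x ! i)) (pos_emb T i)) [0..<length x])"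

definition attention_matrix :: "(real \<Rightarrow> real) \<Rightarrow> attention_head \<Rightarrow> real mat \<Rightarrow> real mat" where
  "attention_matrix rnd H X =
     fp_softmax rnd
       (map_mat (\<lambda>s. rnd (s / sqrt (real (dim_row X))))
         (fp_mult_mat rnd (transpose_mat (fp_mult_mat rnd (W_K H) X)) (fp_mult_mat rnd (W_Q H) X)))"

definition head_output :: "(real \<Rightarrow> real) \<Rightarrow> attention_head \<Rightarrow> real mat \<Rightarrow> real mat" where
  "head_output rnd H X =
     fp_mult_mat rnd (fp_mult_mat rnd (W_V H) X) (transpose_mat (attention_matrix rnd H X))"

definition attention_layer :: "(real \<Rightarrow> real) \<Rightarrow> attention_head list \<Rightarrow> real mat \<Rightarrow> real mat" where
  "attention_layer rnd Hs X =
     foldl (\<lambda>Y H. fp_add_mat rnd Y (fp_mult_mat rnd (W_O H) (head_output rnd H X))) X Hs"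

text \<open>ReLU is applied after every layer of the MLP except the last one.\<close>

definition relu :: "real \<Rightarrow> real" where
  "relu t = max 0 t"

definition affine_layer :: "(real \<Rightarrow> real) \<Rightarrow> real mat \<times> real vec \<Rightarrow> real vec \<Rightarrow> real vec" where
  "affine_layer rnd L y = fp_add_vec rnd (fp_mult_mat_vec rnd (fst L) y) (snd L)"

fun eval_mlp :: "(real \<Rightarrow> real) \<Rightarrow> mlp \<Rightarrow> real vec \<Rightarrow> real vec" where
  "eval_mlp rnd [] y = y"
| "eval_mlp rnd [L] y = affine_layer rnd L y"
| "eval_mlp rnd (L # L' # Ls) y = eval_mlp rnd (L' # Ls) (map_vec relu (affine_layer rnd L y))"

text \<open>
  The MLP has its own rounding map \<open>rnd_mlp\<close>: it may run in the same format as the attention layer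
  (\<open>rnd_mlp = rnd\<close>) or in exact real arithmetic (\<open>rnd_mlp = id\<close>).
\<close>

definition transformer_output ::
    "(real \<Rightarrow> real) \<Rightarrow> (real \<Rightarrow> real) \<Rightarrow> nat \<Rightarrow> transformer \<Rightarrow> nat list \<Rightarrow> real" where
  "transformer_output rnd rnd_mlp d T x =
     eval_mlp rnd_mlp (final_mlp T)
       (col (attention_layer rnd (heads T) (input_matrix rnd d T x)) (length x - 1)) $ 0"


section \<open>The Most Frequent Element task\<close>

definition MFE :: "nat \<Rightarrow> nat list \<Rightarrow> nat" where
  "MFE m x = Max (count_list x ` {1..m})"

definition solves_MFE :: "nat \<Rightarrow> nat \<Rightarrow> (nat list \<Rightarrow> real) \<Rightarrow> bool" where
  "solves_MFE m n f \<longleftrightarrow>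
     (\<forall>x. length x = n \<and> set x \<subseteq> {1..m} \<longrightarrow> f x = real (MFE m x))"

end

theory Submission
  imports Defs
begin

text \<open>
  Two-party communication argument.  Cut the input into a prefix (Alice) and a suffix (Bob) whose last
  token is fixed.  For each head, Alice reveals her partial normalization sum, Bob answers with the
  full one, and Alice then reveals her \<open>d\<close> partial accumulations of the head output.  The output is
  determined by Bob's suffix and this transcript, which consists of \<open>h(d + 2)\<close> stored numbers.
  On the other hand MFE solves equality of \<open>k\<close>-bit strings: for each \<open>i < k\<close> Alice writes one of the
  tokens \<open>2i + 1\<close>, \<open>2i + 2\<close> and Bob the one that his string does not select, so that a token is
  repeated iff the strings differ.  Hence \<open>2^k \<le> 2^(ph(d + 2))\<close>, where \<open>k\<close> can be as large as
  \<open>min m n div 4\<close>.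
\<close>

section \<open>The computation at one position\<close>

lemma fp_sum_append: "fp_sum rnd (xs @ ys) = foldl (\<lambda>s x. rnd (s + x)) (fp_sum rnd xs) ys"
  by (simp add: fp_sum_def)

text \<open>Every accumulation step ends with a rounding. The empty sum is an unrounded
  \<open>0\<close>, which need not be representable.\<close>

lemma fp_sum_in_range: "xs \<noteq> [] \<Longrightarrow> fp_sum rnd xs \<in> range rnd"
  by (cases xs rule: rev_cases) (auto simp: fp_sum_def)

text \<open>Unnormalized softmax numerator. The scores are \<open>K^T Q\<close> with softmax along
  rows, so \<open>W_K\<close> acts on the column \<open>u\<close> of the output position and
  \<open>W_Q\<close> on the attended column \<open>v\<close>.\<close>

definition attention_weight ::
    "(real \<Rightarrow> real) \<Rightarrow> attention_head \<Rightarrow> real vec \<Rightarrow> real vec \<Rightarrow> real" where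
  "attention_weight rnd H u v =
     rnd (exp (rnd (fp_scalar_prod rnd (fp_mult_mat_vec rnd (W_K H) u) (fp_mult_mat_vec rnd (W_Q H) v)
       / sqrt (real (dim_vec u)))))"

definition normalizer ::
    "(real \<Rightarrow> real) \<Rightarrow> attention_head \<Rightarrow> real vec \<Rightarrow> real vec list \<Rightarrow> real" where
  "normalizer rnd H u cs = fp_sum rnd (map (attention_weight rnd H u) cs)"

text \<open>\<open>Z\<close> is kept separate from \<open>cs\<close> so that a partial sum over a
  prefix can use the normalizer of the whole sequence.\<close>

definition weighted_value ::
    "(real \<Rightarrow> real) \<Rightarrow> attention_head \<Rightarrow> real vec \<Rightarrow> real \<Rightarrow> nat \<Rightarrow> real vec list \<Rightarrow> real" where
  "weighted_value rnd H u Z r cs =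
     fp_sum rnd (map (\<lambda>v. rnd (fp_mult_mat_vec rnd (W_V H) v $ r * rnd (attention_weight rnd H u v / Z))) cs)"

definition head_column ::
    "(real \<Rightarrow> real) \<Rightarrow> attention_head \<Rightarrow> real vec \<Rightarrow> real vec list \<Rightarrow> real vec" where
  "head_column rnd H u cs =
     vec (dim_row (W_V H)) (\<lambda>r. weighted_value rnd H u (normalizer rnd H u cs) r cs)"

definition layer_column ::
    "(real \<Rightarrow> real) \<Rightarrow> attention_head list \<Rightarrow> real vec \<Rightarrow> real vec list \<Rightarrow> real vec" where
  "layer_column rnd Hs u cs =
     foldl (\<lambda>y H. fp_add_vec rnd y (fp_mult_mat_vec rnd (W_O H) (head_column rnd H u cs))) u Hs"

lemma col_fp_mult_mat:
  "j < dim_col B \<Longrightarrow> col (fp_mult_mat rnd A B) j = fp_mult_mat_vec rnd A (col B j)"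
  by (auto simp: fp_mult_mat_def fp_mult_mat_vec_def)

lemma dim_fp_mult_mat [simp]:
  "dim_row (fp_mult_mat rnd A B) = dim_row A" "dim_col (fp_mult_mat rnd A B) = dim_col B"
  by (simp_all add: fp_mult_mat_def)

lemma dim_fp_add_mat [simp]:
  "dim_row (fp_add_mat rnd A B) = dim_row B" "dim_col (fp_add_mat rnd A B) = dim_col B"
  by (simp_all add: fp_add_mat_def)

lemma dim_attention_matrix [simp]:
  "dim_row (attention_matrix rnd H X) = dim_col X" "dim_col (attention_matrix rnd H X) = dim_col X"
  by (simp_all add: attention_matrix_def fp_softmax_def Let_def)

lemma dim_head_output [simp]:
  "dim_row (head_output rnd H X) = dim_row (W_V H)" "dim_col (head_output rnd H X) = dim_col X"
  by (simp_all add: head_output_def)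

lemma index_fp_mult_mat:
  "i < dim_row A \<Longrightarrow> j < dim_col B \<Longrightarrow>
     fp_mult_mat rnd A B $$ (i, j) = fp_scalar_prod rnd (row A i) (col B j)"
  by (simp add: fp_mult_mat_def)

lemma attention_matrix_index:
  assumes "j < dim_col X" "l < dim_col X"
  shows "attention_matrix rnd H X $$ (j, l) =
    rnd (attention_weight rnd H (col X j) (col X l) / normalizer rnd H (col X j) (cols X))"
proof -
  let ?S = "map_mat (\<lambda>s. rnd (s / sqrt (real (dim_row X))))
         (fp_mult_mat rnd (transpose_mat (fp_mult_mat rnd (W_K H) X)) (fp_mult_mat rnd (W_Q H) X))"
  have E: "map_mat (\<lambda>s. rnd (exp s)) ?S $$ (j, l) = attention_weight rnd H (col X j) (col X l)"
    if "l < dim_col X" for l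
    using assms(1) that by (simp add: index_fp_mult_mat col_fp_mult_mat attention_weight_def)
  have "map (\<lambda>l. map_mat (\<lambda>s. rnd (exp s)) ?S $$ (j, l)) [0..<dim_col ?S] =
      map (attention_weight rnd H (col X j)) (cols X)"
    unfolding cols_def map_map o_def by (rule map_cong) (auto simp: E simp del: index_map_mat(1))
  then show ?thesis
    using assms E[of l]
    by (simp add: attention_matrix_def fp_softmax_def Let_def normalizer_def del: index_map_mat(1))
qed

lemma col_head_output:
  assumes "j < dim_col X"
  shows "col (head_output rnd H X) j = head_column rnd H (col X j) (cols X)"
proof (rule eq_vecI)
  fix r assume "r < dim_vec (head_column rnd H (col X j) (cols X))"
  then have r: "r < dim_row (W_V H)" by (simp add: head_column_def)
  have "map (\<lambda>l. rnd (row (fp_mult_mat rnd (W_V H) X) r $ l * row (attention_matrix rnd H X) j $ l))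
          [0..<dim_col X] =
      map (\<lambda>v. rnd (fp_mult_mat_vec rnd (W_V H) v $ r *
             rnd (attention_weight rnd H (col X j) v / normalizer rnd H (col X j) (cols X)))) (cols X)"
    unfolding cols_def map_map o_def
    using r assms attention_matrix_index[OF assms]
    by (intro map_cong) (auto simp: cols_def fp_mult_mat_vec_def index_fp_mult_mat)
  then show "col (head_output rnd H X) j $ r = head_column rnd H (col X j) (cols X) $ r"
    using r assms
    by (simp add: head_output_def head_column_def weighted_value_def index_fp_mult_mat fp_scalar_prod_def)
qed (simp add: head_column_def)

lemma col_attention_layer:
  assumes "j < dim_col X" and "\<forall>H\<in>set Hs. dim_row (W_O H) = dim_row X"
  shows "col (attention_layer rnd Hs X) j = layer_column rnd Hs (col X j) (cols X)"
proof -
  \<comment> \<open>Generalized over the residual accumulator \<open>Y\<close>; all heads keep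
    reading the same \<open>X\<close>.\<close>
  have "col (foldl (\<lambda>Y H. fp_add_mat rnd Y (fp_mult_mat rnd (W_O H) (head_output rnd H X))) Y Hs) j =
      foldl (\<lambda>y H. fp_add_vec rnd y (fp_mult_mat_vec rnd (W_O H) (head_column rnd H (col X j) (cols X))))
        (col Y j) Hs"
    if "dim_col Y = dim_col X" "dim_row Y = dim_row X" for Y
    using that assms(2)
  proof (induction Hs arbitrary: Y)
    case (Cons H Hs)
    let ?B = "fp_mult_mat rnd (W_O H) (head_output rnd H X)"
    have "col (fp_add_mat rnd Y ?B) j = fp_add_vec rnd (col Y j) (col ?B j)"
      using Cons.prems assms(1) by (auto simp: fp_add_mat_def fp_add_vec_def)
    also have "col ?B j = fp_mult_mat_vec rnd (W_O H) (head_column rnd H (col X j) (cols X))"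
      using assms(1) by (simp add: col_fp_mult_mat col_head_output)
    finally show ?case
      using Cons.prems by (simp add: Cons.IH)
  qed simp
  then show ?thesis by (simp add: attention_layer_def layer_column_def)
qed

section \<open>The transcript\<close>

text \<open>Quotients are rounded before they are accumulated, so the weighted sums of the prefix
  are formed with the full normalizer instead of being rescaled afterwards.\<close>

definition head_transcript ::
    "(real \<Rightarrow> real) \<Rightarrow> nat \<Rightarrow> real vec \<Rightarrow> real vec list \<Rightarrow> real vec list \<Rightarrow> attention_head \<Rightarrow> real list" where
  "head_transcript rnd d u as bs H =
     normalizer rnd H u as # normalizer rnd H u (as @ bs) #
     map (\<lambda>r. weighted_value rnd H u (normalizer rnd H u (as @ bs)) r as) [0..<d]"

lemma head_transcript_range:
  assumes "as \<noteq> []"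
  shows "head_transcript rnd d u as bs H \<in> {xs. set xs \<subseteq> range rnd \<and> length xs = d + 2}"
  using assms
  by (auto simp: head_transcript_def normalizer_def weighted_value_def intro!: fp_sum_in_range)

text \<open>This is the rectangle property of deterministic protocols: equal transcripts can be crossed.\<close>

lemma head_column_cross:
  assumes "head_transcript rnd d u as bs H = head_transcript rnd d u as' bs' H"
    and "dim_row (W_V H) = d"
  shows "head_column rnd H u (as @ bs') = head_column rnd H u (as' @ bs')"
proof -
  have 1: "normalizer rnd H u as = normalizer rnd H u as'"
    and 2: "normalizer rnd H u (as @ bs) = normalizer rnd H u (as' @ bs')"
    and 3: "\<And>r. r < d \<Longrightarrow> weighted_value rnd H u (normalizer rnd H u (as @ bs)) r as =
      weighted_value rnd H u (normalizer rnd H u (as' @ bs')) r as'"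
    using assms(1) by (auto simp: head_transcript_def)
  \<comment> \<open>Left-to-right accumulation sees the prefix only through its partial sum.\<close>
  have "normalizer rnd H u (as @ bs') = normalizer rnd H u (as' @ bs')"
    using 1 by (simp add: normalizer_def fp_sum_append)
  \<comment> \<open>With \<open>2\<close>, this common value is also the normalizer in
    \<open>3\<close>; the equal prefix sums there are then continued over the same
    \<open>bs'\<close>.\<close>
  then show ?thesis
    using 2 3 assms(2)
    by (auto simp: head_column_def weighted_value_def fp_sum_append)
qed

text \<open>The residual stream starts from the common \<open>u\<close>, and the lists enter only
  through the head columns, so crossing each head suffices.\<close>

lemma layer_column_cross:
  assumes "map (head_transcript rnd d u as bs) Hs = map (head_transcript rnd d u as' bs') Hs"
    and "\<forall>H\<in>set Hs. dim_row (W_V H) = d"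
  shows "layer_column rnd Hs u (as @ bs') = layer_column rnd Hs u (as' @ bs')"
  unfolding layer_column_def
proof (rule foldl_cong)
  fix y H assume "H \<in> set Hs"
  then have "head_column rnd H u (as @ bs') = head_column rnd H u (as' @ bs')"
    using assms by (intro head_column_cross) auto
  then show "fp_add_vec rnd y (fp_mult_mat_vec rnd (W_O H) (head_column rnd H u (as @ bs'))) =
      fp_add_vec rnd y (fp_mult_mat_vec rnd (W_O H) (head_column rnd H u (as' @ bs')))"
    by simp
qed simp_all

text \<open>\<open>j\<close> is the absolute position of the first token: positional embeddings must
  survive cutting the input.\<close>

definition columns_from ::
    "(real \<Rightarrow> real) \<Rightarrow> transformer \<Rightarrow> nat \<Rightarrow> nat list \<Rightarrow> real vec list" where
  "columns_from rnd T j x =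
     map (\<lambda>i. fp_add_vec rnd (token_emb T (x ! i)) (pos_emb T (j + i))) [0..<length x]"

lemma columns_from_append:
  "columns_from rnd T j (x @ y) = columns_from rnd T j x @ columns_from rnd T (j + length x) y"
proof (rule nth_equalityI)
  fix i assume "i < length (columns_from rnd T j (x @ y))"
  then show "columns_from rnd T j (x @ y) ! i =
      (columns_from rnd T j x @ columns_from rnd T (j + length x) y) ! i"
    by (auto simp: columns_from_def nth_append)
qed (simp add: columns_from_def)

text \<open>Only the last column reaches the MLP, so one column of the attention layer determines
  the output.\<close>

lemma transformer_output_eq:
  assumes T: "is_transformer m n d h T" and x: "length x = n" "x \<noteq> []"
  shows "transformer_output rnd rnd_mlp d T x =
    eval_mlp rnd_mlp (final_mlp T)
      (layer_column rnd (heads T) (last (columns_from rnd T 0 x)) (columns_from rnd T 0 x)) $ 0"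
proof -
  let ?X = "input_matrix rnd d T x" and ?cs = "columns_from rnd T 0 x"
  have len: "length ?cs = length x" by (simp add: columns_from_def)
  have X: "?X = mat_of_cols d ?cs" by (simp add: input_matrix_def columns_from_def)
  have "set ?cs \<subseteq> carrier_vec d"
    using T x by (auto simp: columns_from_def is_transformer_def fp_add_vec_def)
  then have cols: "cols ?X = ?cs" unfolding X by (rule cols_mat_of_cols)
  have j: "length x - 1 < dim_col ?X" using x(2) by (simp add: input_matrix_def)
  have "col ?X (length x - 1) = last ?cs"
    using cols_nth[OF j] x len by (metis cols last_conv_nth length_0_conv)
  moreover have "\<forall>H\<in>set (heads T). dim_row (W_O H) = dim_row ?X"
    using T by (auto simp: is_transformer_def input_matrix_def)
  ultimately show ?thesis
    using col_attention_layer[OF j] by (simp add: transformer_output_def cols)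
qed

section \<open>Fooling inputs for MFE\<close>

definition code_word :: "nat \<Rightarrow> nat set \<Rightarrow> nat list" where
  "code_word k S = map (\<lambda>i. if i \<in> S then 2 * i + 1 else 2 * i + 2) [0..<k]"

lemma set_code_word: "set (code_word k S) \<subseteq> {1..2 * k}"
  by (auto simp: code_word_def)

lemma count_list_distinct: "distinct xs \<Longrightarrow> count_list xs z = of_bool (z \<in> set xs)"
  by (induction xs) auto

text \<open>The two words cover both tokens of each of the \<open>k\<close> pairs, and their total
  length \<open>2 * k\<close> leaves no room for a repetition.\<close>

lemma count_code_word_compl:
  "count_list (code_word k S @ code_word k (- S)) z = of_bool (z \<in> {1..2 * k})"
proof -
  have "set (code_word k S @ code_word k (- S)) = {1..2 * k}"
  proof (intro equalityI subsetI)
    fix z assume z: "z \<in> {1..2 * k}"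
    define i where "i = (z - 1) div 2"
    have "i < k" "z = 2 * i + 1 \<or> z = 2 * i + 2" using z unfolding i_def by auto
    then show "z \<in> set (code_word k S @ code_word k (- S))"
      by (auto simp: code_word_def image_iff)
  qed (use set_code_word in force)
  moreover from this have "distinct (code_word k S @ code_word k (- S))"
    by (intro card_distinct) (simp add: code_word_def)
  ultimately show ?thesis
    by (simp only: count_list_distinct)
qed

text \<open>At an index where \<open>S\<close> and \<open>T\<close> differ, the complement of
  \<open>T\<close> selects the same token as \<open>S\<close>.\<close>

lemma code_word_collision:
  assumes "S \<subseteq> {..<k}" "T \<subseteq> {..<k}" "S \<noteq> T"
  shows "\<exists>z\<in>{1..2 * k}. 2 \<le> count_list (code_word k S @ code_word k (- T)) z"
proof -
  obtain i where i: "i < k" "i \<in> S \<longleftrightarrow> i \<notin> T" using assms by blast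
  let ?z = "if i \<in> S then 2 * i + 1 else 2 * i + 2"
  have "?z \<in> set (code_word k S)" "?z \<in> set (code_word k (- T))"
    using i by (auto simp: code_word_def)
  then have "count_list (code_word k S) ?z \<noteq> 0" "count_list (code_word k (- T)) ?z \<noteq> 0"
    by (simp_all only: count_list_0_iff not_not simp_thms)
  then show ?thesis using i(1) by (intro bexI[of _ ?z]) (simp_all only: count_list_append, auto)
qed

text \<open>Fills the input to any length, even far beyond the vocabulary size, while raising all
  code tokens equally, so that a collision still shows in the maximum.\<close>

lemma exists_balanced_padding:
  fixes k l :: nat
  assumes "k \<ge> 1"
  shows "\<exists>w q. length w = l \<and> set w \<subseteq> {1..4 * k} \<and>
    (\<forall>z\<in>{1..2 * k}. count_list w z = q) \<and> (\<forall>z. z \<notin> {1..2 * k} \<longrightarrow> count_list w z \<le> 1)"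
proof -
  define q where "q = l div (2 * k)"
  define r where "r = l mod (2 * k)"
  have r: "r < 2 * k" using assms by (simp add: r_def)
  have l: "l = q * (2 * k) + r" unfolding q_def r_def by (rule div_mult_mod_eq[symmetric])
  \<comment> \<open>\<open>q\<close> full rounds of the code tokens; the remainder
    \<open>r < 2 * k\<close> goes to distinct fresh tokens, for which \<open>4 * k\<close> tokens
    suffice.\<close>
  define w where "w = concat (replicate q [1..<2 * k + 1]) @ [2 * k + 1..<2 * k + 1 + r]"
  have cr: "count_list (concat (replicate q xs)) z = q * count_list xs z" for xs and z :: nat
    by (induction q) auto
  have cu: "count_list [a..<b] z = of_bool (z \<in> {a..<b})" for a b z :: nat
    by (simp add: count_list_distinct)
  have "length w = l" by (simp add: w_def l length_concat sum_list_replicate)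
  moreover have "set w \<subseteq> {1..4 * k}" using r by (auto simp: w_def)
  moreover have "count_list w z = q * of_bool (z \<in> {1..<2*k+1}) + of_bool (z \<in> {2*k+1..<2*k+1+r})" for z
    by (simp only: w_def count_list_append cr cu)
  ultimately show ?thesis by (intro exI[of _ w] exI[of _ q]) auto
qed

section \<open>The lower bound\<close>

text \<open>The \<open>2 ^ k\<close> inputs with \<open>S = U\<close> form a fooling set: equal
  transcripts for two of them would give a crossed input the value \<open>q + 1\<close>, although
  its true value is at least \<open>q + 2\<close>.\<close>

lemma transcript_bound:
  assumes rnd: "p_bit_rounding p rnd" and T: "is_transformer m n d h T"
    and solves: "solves_MFE m n (transformer_output rnd rnd_mlp d T)"
    and k: "k \<ge> 1" "4 * k \<le> m" "4 * k \<le> n"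
  shows "k \<le> p * (d + 2) * h"
proof -
  obtain w q where w: "length w = n - 2 * k" "set w \<subseteq> {1..4 * k}"
      "\<And>z. z \<in> {1..2 * k} \<Longrightarrow> count_list w z = q"
      "\<And>z. z \<notin> {1..2 * k} \<Longrightarrow> count_list w z \<le> 1"
    using exists_balanced_padding[OF k(1)] by metis
  \<comment> \<open>The last token thus lies in the padding, so its column \<open>u\<close> depends
    on neither string.\<close>
  have w_ne: "w \<noteq> []" using w(1) k by auto
  define input where "input S U = code_word k S @ code_word k (- U) @ w" for S U
  have len: "length (input S U) = n" for S U
    using w(1) k by (simp add: input_def code_word_def)
  have input: "length (input S U) = n" "set (input S U) \<subseteq> {1..m}" for S U
  proof -
    have "{1..2 * k} \<subseteq> {1..m}" "{1..4 * k} \<subseteq> {1..m}" using k by auto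
    then show "set (input S U) \<subseteq> {1..m}"
      using w(2) set_code_word[of k S] set_code_word[of k "- U"]
      unfolding input_def set_append by blast
  qed (rule len)
  have MFE_diag: "MFE m (input S S) = q + 1" for S
    unfolding MFE_def
  proof (rule Max_eqI)
    have cnt: "count_list (input S S) z = of_bool (z \<in> {1..2 * k}) + count_list w z" for z
      using count_code_word_compl[of k S z] by (simp add: input_def)
    show "q + 1 \<in> count_list (input S S) ` {1..m}"
      using k cnt[of 1] w(3)[of 1] by (intro image_eqI[of _ _ 1]) auto
    fix y assume "y \<in> count_list (input S S) ` {1..m}"
    then obtain z where "y = of_bool (z \<in> {1..2 * k}) + count_list w z"
      unfolding cnt by (rule imageE)
    \<comment> \<open>A code token occurs \<open>1 + q\<close> times, any other token at most once,
      which is within \<open>q + 1\<close> even if \<open>q = 0\<close>.\<close>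
    then show "y \<le> q + 1" using w(3)[of z] w(4)[of z] by (cases "z \<in> {1..2 * k}") auto
  qed simp
  have MFE_off: "MFE m (input S U) \<ge> q + 2" if SU: "S \<subseteq> {..<k}" "U \<subseteq> {..<k}" "S \<noteq> U" for S U
  proof -
    obtain z where z: "z \<in> {1..2 * k}" "2 \<le> count_list (code_word k S @ code_word k (- U)) z"
      using code_word_collision[OF SU] by blast
    have "q + 2 \<le> count_list (input S U) z" using z w(3)[of z] by (simp add: input_def)
    also have "\<dots> \<le> MFE m (input S U)"
      unfolding MFE_def using z(1) k by (intro Max_ge) auto
    finally show ?thesis .
  qed
  define A where "A S = columns_from rnd T 0 (code_word k S)" for S
  define B where "B U = columns_from rnd T k (code_word k (- U) @ w)" for U
  define u where "u = last (columns_from rnd T (2 * k) w)"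
  have cs: "columns_from rnd T 0 (input S U) = A S @ B U" for S U
    by (simp add: input_def A_def B_def columns_from_append code_word_def)
  have last: "last (A S @ B U) = u" for S U
    using w_ne by (simp add: B_def u_def columns_from_append columns_from_def[of _ _ _ w]
        code_word_def mult_2)
  have out: "transformer_output rnd rnd_mlp d T (input S U) =
      eval_mlp rnd_mlp (final_mlp T) (layer_column rnd (heads T) u (A S @ B U)) $ 0" for S U
    using transformer_output_eq[OF T len] w_ne cs last by (simp add: input_def)
  define \<Phi> where "\<Phi> S = map (head_transcript rnd d u (A S) (B S)) (heads T)" for S
  have inj: "inj_on \<Phi> (Pow {..<k})"
  proof (rule inj_onI, rule ccontr)
    fix S U assume SU: "S \<in> Pow {..<k}" "U \<in> Pow {..<k}" "\<Phi> S = \<Phi> U" "S \<noteq> U"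
    have "\<forall>H\<in>set (heads T). dim_row (W_V H) = d" using T by (auto simp: is_transformer_def)
    \<comment> \<open>Bob's suffix \<open>B U\<close> stays; Alice's prefix \<open>A U\<close> is
      exchanged for \<open>A S\<close>.\<close>
    then have "layer_column rnd (heads T) u (A S @ B U) = layer_column rnd (heads T) u (A U @ B U)"
      using SU(3) unfolding \<Phi>_def by (intro layer_column_cross)
    then have "real (MFE m (input S U)) = real (MFE m (input U U))"
      using out solves input by (simp add: solves_MFE_def)
    then show False using MFE_off[of S U] MFE_diag[of U] SU by simp
  qed
  let ?R = "range rnd"
  let ?L = "{xs. set xs \<subseteq> ?R \<and> length xs = d + 2}"
  let ?M = "{ys. set ys \<subseteq> ?L \<and> length ys = h}"
  have finR: "finite ?R" and cardR: "card ?R \<le> 2 ^ p"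
    using rnd by (auto simp: p_bit_rounding_def)
  have finL: "finite ?L" by (rule finite_lists_length_eq[OF finR])
  \<comment> \<open>A nonempty prefix makes every transcript entry a stored number.\<close>
  have "A S \<noteq> []" for S using k by (simp add: A_def columns_from_def code_word_def)
  then have "\<Phi> ` Pow {..<k} \<subseteq> ?M"
    using head_transcript_range T by (fastforce simp: \<Phi>_def is_transformer_def)
  then have "card (Pow {..<k}) \<le> card ?M"
    using inj finite_lists_length_eq[OF finL] by (intro card_inj_on_le)
  also have "card ?M = (card ?R ^ (d + 2)) ^ h"
    by (simp only: card_lists_length_eq[OF finL] card_lists_length_eq[OF finR])
  also have "\<dots> \<le> ((2 ^ p) ^ (d + 2)) ^ h"
    using cardR by (intro power_mono) auto
  also have "\<dots> = 2 ^ (p * (d + 2) * h)" by (simp only: power_mult)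
  finally show ?thesis by (simp add: card_Pow)
qed

theorem theorem5p1:
  "\<exists>c::real. c > 0 \<and>
     (\<forall>(m::nat) (n::nat) (d::nat) (h::nat) (p::nat) (T::transformer)
        (rnd::real \<Rightarrow> real) (rnd_mlp::real \<Rightarrow> real).
        m \<ge> 1 \<and> n \<ge> 1 \<and> d \<ge> 1 \<and> h \<ge> 1 \<and> p \<ge> 1 \<and>
        p_bit_rounding p rnd \<and>
        is_transformer m n d h T \<and>
        solves_MFE m n (transformer_output rnd rnd_mlp d T)
        \<longrightarrow> real (d * h * p) \<ge> c * real (min m n))"
proof (intro exI[of _ "1 / 16"] conjI allI impI)
  fix m n d h p :: nat and T :: transformer and rnd rnd_mlp :: "real \<Rightarrow> real"
  assume asm: "m \<ge> 1 \<and> n \<ge> 1 \<and> d \<ge> 1 \<and> h \<ge> 1 \<and> p \<ge> 1 \<and>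
        p_bit_rounding p rnd \<and>
        is_transformer m n d h T \<and>
        solves_MFE m n (transformer_output rnd rnd_mlp d T)"
  define k where "k = min m n div 4"
  \<comment> \<open>\<open>d + 2 \<le> 3 * d\<close> because \<open>d \<ge> 1\<close>.\<close>
  have "p * (d + 2) * h \<le> p * (3 * d) * h" using asm by (intro mult_le_mono) auto
  moreover have "k \<le> p * (d + 2) * h"
    using transcript_bound[of p rnd m n d h T rnd_mlp k] asm
    by (cases "k = 0") (auto simp: k_def)
  moreover have "p * (3 * d) * h = 3 * (d * h * p)" by (simp only: mult_ac)
  ultimately have "k \<le> 3 * (d * h * p)" by linarith
  moreover have "1 \<le> d * h * p" using asm by simp
  moreover have "min m n \<le> 4 * k + 3" unfolding k_def by linarith
  \<comment> \<open>\<open>4 * k\<close> contributes at most 12 times \<open>d * h * p\<close> and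
    the remainder 3 at most 3 times; 15 is rounded up to 16.\<close>
  ultimately have "min m n \<le> 16 * (d * h * p)" by linarith
  then have "real (min m n) \<le> 16 * real (d * h * p)"
    by (metis of_nat_le_iff of_nat_mult of_nat_numeral)
  then show "real (d * h * p) \<ge> 1 / 16 * real (min m n)" by simp
qed simp

end
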